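(* Let $a_n>0$, $b_n\in\mathbb{R}$ ($n\ge1$) and let $T$ be the associated symmetric tridiagonal operator. Suppose that $\lim_{n\to\infty}|b_n|=\infty$ and that for some real $r<1$ both $a_n=o(|b_n|^r)$ and $a_{n-1}=o(|b_n|^r)$ as $n\to\infty$. Then the Jacobi continued fraction $$K(\lambda)=\cfrac{1}{\lambda-b_1-\cfrac{a_1^2}{\lambda-b_2-\cfrac{a_2^2}{\lambda-b_3-\cdots}}}$$ represents a meromorphic function in $\mathbb{C}$. This continued fraction converges uniformly on compact subsets of $\mathbb{C}\setminus\bigcup_n\{\lambda_n\}$, where $\lambda_n$ are the eigenvalues of $T$.
   Context: $(H,(\cdot,\cdot))$ is an infinite-dimensional complex Hilbert space with orthonormal basis $\{e_n\}_{n=1}^\infty$. Given real sequences $a_n>0$, $b_n\in\mathbb{R}$ ($n\ge1$), the formula $Te_n=a_ne_{n+1}+b_ne_n+a_{n-1}e_{n-1}$ (with $e_0=0$) defines a symmetric operator on the linear span of $\{e_n\}_{n=1}^\infty$; $T$ denotes the closure of this operator. The notation $y_n=o(z_n)$ means $\lim_{n\to\infty}y_n/z_n=0$. Convergence of the continued fraction means convergence, as $N\to\infty$, of its approximants $K_N(\lambda)$, the finite continued fractions obtained by stopping at the term $\lambda-b_N$ (rational functions of $\lambda$); uniform convergence on a compact set means that for all sufficiently large $N$ the approximants have no poles on that set and they converge uniformly there. "Represents a meromorphic function" means that the limit function is (the restriction of) a function meromorphic in $\mathbb{C}$. *)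

theory Defs
  imports "HOL-Complex_Analysis.Complex_Analysis"
begin

section \<open>Complex Hilbert spaces\<close>

text \<open>
  The norm and the real vector space structure come from \<^class>\<open>banach\<close>, which also
  provides completeness; the axioms tie them to a complex scalar multiplication and to an inner
  product that is linear in its first argument. Positive definiteness is part of
  \<open>cinner_self\<close>.
\<close>

class chilbert_space = banach +
  fixes scaleC :: "complex \<Rightarrow> 'a \<Rightarrow> 'a"  (infixr \<open>*\<^sub>C\<close> 75)
    and cinner :: "'a \<Rightarrow> 'a \<Rightarrow> complex"
  assumes scaleC_add_right: "c *\<^sub>C (x + y) = c *\<^sub>C x + c *\<^sub>C y"
    and scaleC_add_left: "(c + d) *\<^sub>C x = c *\<^sub>C x + d *\<^sub>C x"
    and scaleC_scaleC: "c *\<^sub>C (d *\<^sub>C x) = (c * d) *\<^sub>C x"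
    and scaleC_of_real: "complex_of_real t *\<^sub>C x = t *\<^sub>R x"
    and cinner_commute: "cinner x y = cnj (cinner y x)"
    and cinner_add_left: "cinner (x + y) z = cinner x z + cinner y z"
    and cinner_scaleC_left: "cinner (c *\<^sub>C x) y = c * cinner x y"
    and cinner_self: "cinner x x = complex_of_real ((norm x)\<^sup>2)"

lemma vector_space_scaleC: "vector_space (scaleC :: complex \<Rightarrow> 'a::chilbert_space \<Rightarrow> 'a)"
proof
  fix x :: 'a
  show "1 *\<^sub>C x = x"
    using scaleC_of_real[of 1 x] by simp
qed (auto simp: scaleC_add_right scaleC_add_left scaleC_scaleC)

global_interpretation complex_vector:
  vector_space "scaleC :: complex \<Rightarrow> 'a::chilbert_space \<Rightarrow> 'a"
  defines cspan = complex_vector.span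
  by (rule vector_space_scaleC)

text \<open>Orthonormal bases are indexed by the positive integers; \<open>e 0\<close> is not part of the basis.\<close>

definition orthonormal_basis :: "(nat \<Rightarrow> 'a::chilbert_space) \<Rightarrow> bool" where
  "orthonormal_basis e \<longleftrightarrow>
     (\<forall>m\<ge>1. \<forall>n\<ge>1. cinner (e m) (e n) = (if m = n then 1 else 0)) \<and>
     closure (cspan (e ` {1..})) = UNIV"


section \<open>The tridiagonal operator\<close>

text \<open>
  Unbounded operators are identified with their graphs, so that the closure of an operator is the
  topological closure of its graph. The coefficient \<open>a 0\<close> plays no role, because the
  operator is always used with \<open>e 0 = 0\<close>.
\<close>

definition jacobi_vec ::
  "(nat \<Rightarrow> 'a::chilbert_space) \<Rightarrow> (nat \<Rightarrow> real) \<Rightarrow> (nat \<Rightarrow> real) \<Rightarrow> nat \<Rightarrow> 'a" where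
  "jacobi_vec e a b n = a n *\<^sub>R e (n + 1) + b n *\<^sub>R e n + a (n - 1) *\<^sub>R e (n - 1)"

definition jacobi_span_operator ::
  "(nat \<Rightarrow> 'a::chilbert_space) \<Rightarrow> (nat \<Rightarrow> real) \<Rightarrow> (nat \<Rightarrow> real) \<Rightarrow> ('a \<times> 'a) set" where
  "jacobi_span_operator e a b =
     {(\<Sum>n\<in>S. c n *\<^sub>C e n, \<Sum>n\<in>S. c n *\<^sub>C jacobi_vec e a b n) | S c. finite S \<and> S \<subseteq> {1..}}"

definition jacobi_operator ::
  "(nat \<Rightarrow> 'a::chilbert_space) \<Rightarrow> (nat \<Rightarrow> real) \<Rightarrow> (nat \<Rightarrow> real) \<Rightarrow> ('a \<times> 'a) set" where
  "jacobi_operator e a b = closure (jacobi_span_operator e a b)"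

definition eigenvalues :: "('a::chilbert_space \<times> 'a) set \<Rightarrow> complex set" where
  "eigenvalues T = {l. \<exists>x. x \<noteq> 0 \<and> (x, l *\<^sub>C x) \<in> T}"


section \<open>The continued fraction\<close>

text \<open>
  \<open>jacobi_denom a b m k z\<close> is the finite expression
  \<open>z - b k - (a k)\<^sup>2 / (z - b (k+1) - (a (k+1))\<^sup>2 / (\<dots> / (z - b (k+m))))\<close>.
\<close>

primrec jacobi_denom ::
  "(nat \<Rightarrow> real) \<Rightarrow> (nat \<Rightarrow> real) \<Rightarrow> nat \<Rightarrow> nat \<Rightarrow> complex \<Rightarrow> complex" where
  "jacobi_denom a b 0 k z = z - of_real (b k)"
| "jacobi_denom a b (Suc m) k z =
     z - of_real (b k) - (of_real (a k))\<^sup>2 / jacobi_denom a b m (Suc k) z"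

text \<open>
  The approximant \<open>K\<^sub>N\<close>, for \<open>N \<ge> 1\<close>, is the finite continued fraction
  that stops at \<open>z - b N\<close>, as a rational function of \<open>z\<close>. Evaluated pointwise
  with \<open>x / 0 = 0\<close>, the nested fraction has the wrong value at the finitely many
  \<open>z\<close> where an inner denominator vanishes: for \<open>N = 2\<close> and \<open>z = b 2\<close>
  it gives \<open>1 / (z - b 1)\<close> instead of \<open>0\<close>.
  \<^const>\<open>remove_sings\<close> restores the values of the rational function at all points that are
  not poles (and assigns \<open>0\<close> at the poles).
\<close>

definition jacobi_approximant ::
  "(nat \<Rightarrow> real) \<Rightarrow> (nat \<Rightarrow> real) \<Rightarrow> nat \<Rightarrow> complex \<Rightarrow> complex" where
  "jacobi_approximant a b N = remove_sings (\<lambda>z. 1 / jacobi_denom a b (N - 1) 1 z)"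

end

theory Submission
  imports Defs
begin

text \<open>
  Since \<open>a\<^sub>n = o(|b\<^sub>n|)\<close> and \<open>a\<^sub>n\<^sub>-\<^sub>1 = o(|b\<^sub>n|)\<close>, on every disc the tails of the continued fraction from
  some index \<open>m\<close> on are iterates of contractions and converge uniformly to a zero-free holomorphic
  function \<open>D\<^sub>m\<close>. By the splitting identity for continuants, the approximants are quotients of
  fixed polynomial combinations of the reciprocal tail, so on the disc the limit is a quotient
  \<open>V / U\<close> of holomorphic functions, where \<open>U\<close> does not vanish in the upper half plane. At a zero
  of \<open>U\<close> the solution \<open>x\<^sub>1 = 1, x\<^sub>2, \<dots>\<close> of the three-term recurrence satisfies
  \<open>x\<^sub>k\<^sub>+\<^sub>1 = a\<^sub>k x\<^sub>k / D\<^sub>k\<^sub>+\<^sub>1\<close> for large \<open>k\<close>. Both \<open>x\<^sub>k\<close> and \<open>a\<^sub>k x\<^sub>k\<close> then decay geometrically, so \<open>x\<close> is an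
  eigenvector of the closure \<open>T\<close>.
\<close>


section \<open>Continuants\<close>

text \<open>
  Determinant of \<open>z - J\<close>, where \<open>J\<close> is the \<open>n \<times> n\<close> Jacobi block with rows
  and columns \<open>k, \<dots>, k + n - 1\<close>.
\<close>

fun continuant :: "(nat \<Rightarrow> real) \<Rightarrow> (nat \<Rightarrow> real) \<Rightarrow> nat \<Rightarrow> nat \<Rightarrow> complex \<Rightarrow> complex" where
  "continuant a b 0 k z = 1"
| "continuant a b (Suc 0) k z = z - of_real (b k)"
| "continuant a b (Suc (Suc n)) k z =
     (z - of_real (b k)) * continuant a b (Suc n) (Suc k) z
     - (of_real (a k))\<^sup>2 * continuant a b n (Suc (Suc k)) z"

text \<open>Laplace expansion of the determinant across the cut between the indices
  \<open>k + p\<close> and \<open>k + p + 1\<close>: only the entry \<open>a (k + p)\<close> couples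
  the two diagonal blocks. In \<open>p\<close>, both sides obey the recurrence that defines
  \<open>continuant\<close>.\<close>

lemma continuant_split:
  "continuant a b (Suc (p + Suc q)) k z =
     continuant a b (Suc p) k z * continuant a b (Suc q) (Suc (k + p)) z
     - (of_real (a (k + p)))\<^sup>2 * continuant a b p k z * continuant a b q (Suc (Suc (k + p))) z"
proof (induction p arbitrary: k rule: less_induct)
  case (less p)
  consider "p = 0" | "p = 1" | p' where "p = Suc (Suc p')"
    by (metis One_nat_def not0_implies_Suc)
  then show ?case
  proof cases
    case 3
    have "continuant a b (Suc (p + Suc q)) k z =
        (z - of_real (b k)) * continuant a b (Suc (Suc p' + Suc q)) (Suc k) z
        - (of_real (a k))\<^sup>2 * continuant a b (Suc (p' + Suc q)) (Suc (Suc k)) z"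
      by (simp add: 3)
    then show ?thesis
      by (simp only: less.IH[of "Suc p'"] less.IH[of p'] 3) (simp add: algebra_simps)
  qed (simp_all add: algebra_simps)
qed

text \<open>Expansion along the last row instead of the first. The left end stays fixed, as in the
  three-term recurrence of orthogonal polynomials.\<close>

lemma continuant_Suc_right:
  "continuant a b (Suc (Suc n)) k z =
     (z - of_real (b (Suc (k + n)))) * continuant a b (Suc n) k z
     - (of_real (a (k + n)))\<^sup>2 * continuant a b n k z"
  using continuant_split[of a b n 0 k z] by (simp add: mult.commute)

lemma holomorphic_continuant [holomorphic_intros]:
  "(\<lambda>z. continuant a b n k z) holomorphic_on A"
proof (induction n arbitrary: k rule: less_induct)
  case (less n)
  consider "n = 0" | "n = 1" | n' where "n = Suc (Suc n')"
    by (metis One_nat_def not0_implies_Suc)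
  then show ?case
    by cases (auto intro!: holomorphic_intros less.IH)
qed

section \<open>Continuants in the upper half plane and the nested fraction\<close>

lemma Im_square_divide_nonpos: "Im w \<ge> 0 \<Longrightarrow> Im ((of_real t)\<^sup>2 / w) \<le> 0"
  by (auto simp: Im_divide power2_eq_square intro!: divide_nonpos_nonneg mult_nonneg_nonneg)

text \<open>Successive quotients obey \<open>q' = z - b - a^2 / q\<close>, a step that preserves
  \<open>Im q \<ge> Im z\<close>. In matrix terms, a finite Jacobi block has no eigenvalue in the
  upper half plane.\<close>

lemma continuant_upper_half_plane:
  assumes "Im z > 0"
  shows "continuant a b n k z \<noteq> 0 \<and> Im (continuant a b (Suc n) k z / continuant a b n k z) \<ge> Im z"
proof (induction n)
  case (Suc n)
  define q where "q = continuant a b (Suc n) k z / continuant a b n k z"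
  have nz: "continuant a b (Suc n) k z \<noteq> 0"
    using Suc assms by auto
  then have "continuant a b (Suc (Suc n)) k z / continuant a b (Suc n) k z =
      z - of_real (b (Suc (k + n))) - (of_real (a (k + n)))\<^sup>2 / q"
    by (simp only: continuant_Suc_right q_def) (simp add: field_simps)
  moreover have "Im ((of_real (a (k + n)))\<^sup>2 / q) \<le> 0"
    using Suc assms by (intro Im_square_divide_nonpos) (auto simp: q_def)
  ultimately show ?case
    using nz by simp
qed simp

text \<open>The zeros of an entire function with a nonzero value at \<open>\<i>\<close> are
  isolated, so continuants may be divided by at generic points.\<close>

lemma eventually_continuant_nonzero: "\<forall>\<^sub>F w in at z. continuant a b n k w \<noteq> 0"
proof -
  have "\<forall>\<^sub>F w in at z. continuant a b n k w \<noteq> 0 \<and> w \<in> UNIV"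
    by (rule non_zero_neighbour_alt[of _ UNIV z "\<i>"])
       (use continuant_upper_half_plane[of "\<i>" a b n k] in \<open>auto intro!: holomorphic_continuant\<close>)
  then show ?thesis by simp
qed

text \<open>The nested fraction is a ratio of determinants. The assumption concerns the blocks that
  start after \<open>k\<close> and end at \<open>k + j\<close>; their nonvanishing excludes division
  by zero inside the fraction.\<close>

lemma continuant_Suc_eq_jacobi_denom:
  assumes "\<And>i l. i \<le> j \<Longrightarrow> i + l = Suc (k + j) \<Longrightarrow> continuant a b i l z \<noteq> 0"
  shows "continuant a b (Suc j) k z = jacobi_denom a b j k z * continuant a b j (Suc k) z"
  using assms
proof (induction j arbitrary: k)
  case (Suc j)
  have IH: "continuant a b (Suc j) (Suc k) z =
      jacobi_denom a b j (Suc k) z * continuant a b j (Suc (Suc k)) z"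
    by (rule Suc.IH) (use Suc.prems in auto)
  moreover have "continuant a b (Suc j) (Suc k) z \<noteq> 0"
    by (rule Suc.prems) auto
  ultimately show ?case
    by (auto simp: field_simps)
qed simp

text \<open>\<open>remove_sings\<close> depends only on punctured neighbourhoods, where the nested
  fraction equals the quotient of continuants. That quotient is analytic wherever its denominator is
  nonzero.\<close>

lemma jacobi_approximant_eq:
  assumes "continuant a b (Suc n) 1 z \<noteq> 0"
  shows "jacobi_approximant a b (Suc n) z = continuant a b n 2 z / continuant a b (Suc n) 1 z"
    and "\<not> is_pole (jacobi_approximant a b (Suc n)) z"
proof -
  define g where "g w = continuant a b n 2 w / continuant a b (Suc n) 1 w" for w
  define S where "S = {w. continuant a b (Suc n) 1 w \<noteq> 0}"
  have "open S"
    unfolding S_def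
    by (intro open_Collect_neq holomorphic_on_imp_continuous_on holomorphic_intros)
  moreover have g_holo: "g holomorphic_on S"
    unfolding g_def by (auto simp: S_def intro!: holomorphic_intros)
  ultimately have g_an: "g analytic_on {w}" if "w \<in> S" for w
    using that analytic_at by blast
  have ev: "\<forall>\<^sub>F w in at w0. 1 / jacobi_denom a b n 1 w = g w" for w0
  proof -
    \<comment> \<open>These are the blocks ending at index \<open>Suc n\<close>. There are finitely
      many, so near \<open>w0\<close> none of them vanishes.\<close>
    have "\<forall>\<^sub>F w in at w0. \<forall>i\<in>{..Suc n}. continuant a b i (Suc (Suc n) - i) w \<noteq> 0"
      by (intro eventually_ball_finite ballI eventually_continuant_nonzero) auto
    then show ?thesis
    proof eventually_elim
      case (elim w)
      have "continuant a b (Suc n) 1 w = jacobi_denom a b n 1 w * continuant a b n (Suc 1) w"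
      proof (rule continuant_Suc_eq_jacobi_denom)
        fix i l assume "i \<le> n" "i + l = Suc (1 + n)"
        then have "l = Suc (Suc n) - i" "i \<in> {..Suc n}" by auto
        then show "continuant a b i l w \<noteq> 0" using elim by blast
      qed
      moreover have "continuant a b (Suc n) 1 w \<noteq> 0"
        using elim by (metis atMost_iff diff_Suc_Suc diff_self_eq_0 le_refl Suc_diff_le One_nat_def)
      ultimately show ?case
        by (auto simp: g_def numeral_2_eq_2)
    qed
  qed
  have eq: "jacobi_approximant a b (Suc n) w = g w" if "w \<in> S" for w
    using remove_sings_cong[OF ev[of w] refl] remove_sings_at_analytic[OF g_an[OF that]]
    by (simp add: jacobi_approximant_def)
  have z: "z \<in> S"
    using assms by (simp add: S_def)
  then show "jacobi_approximant a b (Suc n) z = continuant a b n 2 z / continuant a b (Suc n) 1 z"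
    using eq by (simp add: g_def)
  \<comment> \<open>A pole is a matter of nearby values, so the formula is used on the whole open
    set \<open>S\<close>.\<close>
  have "jacobi_approximant a b (Suc n) holomorphic_on S"
    using g_holo eq holomorphic_cong by metis
  then show "\<not> is_pole (jacobi_approximant a b (Suc n)) z"
    using \<open>open S\<close> z not_is_pole_holomorphic by blast
qed


section \<open>Convergence of the tails\<close>

text \<open>
  If \<open>4 a\<^sub>k\<close> is below both \<open>|z - b\<^sub>k|\<close> and \<open>|z - b\<^sub>k\<^sub>+\<^sub>1|\<close>, then the maps
  \<open>w \<mapsto> z - b\<^sub>k - a\<^sub>k\<^sup>2 / w\<close> preserve the lower bound \<open>|z - b\<^sub>k| / 2\<close> and are contractions
  with respect to errors measured relative to \<open>|z - b\<^sub>k|\<close>.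
\<close>

definition dominated :: "(nat \<Rightarrow> real) \<Rightarrow> (nat \<Rightarrow> real) \<Rightarrow> nat \<Rightarrow> complex \<Rightarrow> bool" where
  "dominated a b m z \<longleftrightarrow> (\<forall>k\<ge>m. 0 < a k \<and> 4 * a k \<le> norm (z - of_real (b k)) \<and>
     4 * a k \<le> norm (z - of_real (b (Suc k))))"

lemma dominatedD:
  assumes "dominated a b m z" "m \<le> k"
  shows "0 < a k" "4 * a k \<le> norm (z - of_real (b k))" "4 * a k \<le> norm (z - of_real (b (Suc k)))"
  using assms by (auto simp: dominated_def)

lemma dominated_pos:
  assumes "dominated a b m z" "m \<le> k"
  shows "norm (z - of_real (b k)) > 0"
  using dominatedD[OF assms] by linarith

text \<open>The bound on \<open>w\<close> gives \<open>2 * a k \<le> norm w\<close>. The fraction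
  thus perturbs \<open>z - b k\<close> by at most half its modulus, and the lower bound reproduces
  itself one level further out.\<close>

lemma dominated_step:
  fixes w :: complex
  assumes "dominated a b m z" "m \<le> k" "norm (z - of_real (b (Suc k))) / 2 \<le> norm w"
  shows "norm ((of_real (a k))\<^sup>2 / w) \<le> norm (z - of_real (b k)) / 2"
proof -
  note d = dominatedD[OF assms(1,2)]
  have w: "2 * a k \<le> norm w" "norm w > 0" using d assms(3) by linarith+
  have "(a k)\<^sup>2 \<le> a k * norm w"
    using w(1) d(1) by (simp add: power2_eq_square)
  also have "\<dots> \<le> norm (z - of_real (b k)) / 2 * norm w"
    using d w(2) by (intro mult_right_mono) auto
  finally show ?thesis
    using w(2) by (simp add: norm_divide norm_power divide_le_eq)
qed

lemma jacobi_denom_lower_bound: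
  assumes "dominated a b m z" "m \<le> k"
  shows "norm (z - of_real (b k)) / 2 \<le> norm (jacobi_denom a b j k z)"
  using assms(2)
proof (induction j arbitrary: k)
  case (Suc j)
  have "norm ((of_real (a k))\<^sup>2 / jacobi_denom a b j (Suc k) z) \<le> norm (z - of_real (b k)) / 2"
    using Suc by (intro dominated_step[OF assms(1)]) auto
  moreover have "norm (z - of_real (b k)) - norm ((of_real (a k))\<^sup>2 / jacobi_denom a b j (Suc k) z)
      \<le> norm (jacobi_denom a b (Suc j) k z)"
    by (simp only: jacobi_denom.simps norm_triangle_ineq2)
  ultimately show ?case
    by linarith
qed simp

lemma jacobi_denom_nonzero:
  assumes "dominated a b m z" "m \<le> k"
  shows "jacobi_denom a b j k z \<noteq> 0"
  using jacobi_denom_lower_bound[OF assms, of j] dominated_pos[OF assms] by auto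

text \<open>Passing one level outward multiplies a difference \<open>w - w'\<close> by
  \<open>(a k)^2 / (w * w')\<close>. Relative to the scales \<open>norm (z - b k)\<close> this gains
  a factor 1/2, and since \<open>p\<close> is arbitrary the result is a Cauchy estimate.\<close>

lemma jacobi_denom_diff:
  assumes "dominated a b m z" "m \<le> k"
  shows "norm (jacobi_denom a b (j + p) k z - jacobi_denom a b j k z)
           \<le> norm (z - of_real (b k)) * (1 / 2) ^ j"
  using assms(2)
proof (induction j arbitrary: k)
  case 0
  show ?case
  proof (cases p)
    case (Suc p')
    have "norm ((of_real (a k))\<^sup>2 / jacobi_denom a b p' (Suc k) z) \<le> norm (z - of_real (b k)) / 2"
      using 0 by (intro dominated_step[OF assms(1)] jacobi_denom_lower_bound[OF assms(1)]) auto
    then show ?thesis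
      using norm_ge_zero[of "z - of_real (b k)"] by (simp add: Suc del: norm_ge_zero)
  qed auto
next
  case (Suc j)
  define w w' where "w = jacobi_denom a b (j + p) (Suc k) z" and "w' = jacobi_denom a b j (Suc k) z"
  define B B' where "B = norm (z - of_real (b k))" and "B' = norm (z - of_real (b (Suc k)))"
  have d: "0 < a k" "4 * a k \<le> B" "4 * a k \<le> B'"
    using dominatedD[OF assms(1) Suc.prems] by (auto simp: B_def B'_def)
  have nz: "w \<noteq> 0" "w' \<noteq> 0"
    using Suc.prems by (auto simp: w_def w'_def intro!: jacobi_denom_nonzero[OF assms(1)])
  have wB: "B' / 2 \<le> norm w" "B' / 2 \<le> norm w'"
    using jacobi_denom_lower_bound[OF assms(1) le_SucI[OF Suc.prems]]
    by (auto simp: w_def w'_def B'_def)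
  have IH: "norm (w - w') \<le> B' * (1 / 2) ^ j"
    unfolding w_def w'_def B'_def using Suc by auto
  \<comment> \<open>The product of \<open>4 * a k \<le> B\<close>,
    \<open>2 * a k \<le> norm w\<close> and \<open>B' \<le> 2 * norm w'\<close> gives the relative
    factor 1/4, of which 1/2 is kept.\<close>
  have "4 * a k * (2 * a k) \<le> B * norm w"
    using d wB by (intro mult_mono) auto
  then have "4 * a k * (2 * a k) * B' \<le> B * norm w * (2 * norm w')"
    using d wB by (intro mult_mono) auto
  then have "4 * ((a k)\<^sup>2 * B') \<le> B * (norm w * norm w')"
    by (simp add: power2_eq_square algebra_simps)
  moreover have "0 \<le> (a k)\<^sup>2 * B'"
    by (simp add: B'_def)
  ultimately have key: "(a k)\<^sup>2 * B' \<le> B / 2 * (norm w * norm w')"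
    by simp
  have "jacobi_denom a b (Suc j + p) k z - jacobi_denom a b (Suc j) k z =
      (of_real (a k))\<^sup>2 * (w - w') / (w * w')"
    using nz by (simp add: w_def w'_def field_simps)
  then have "norm (jacobi_denom a b (Suc j + p) k z - jacobi_denom a b (Suc j) k z) =
      (a k)\<^sup>2 * norm (w - w') / (norm w * norm w')"
    by (simp add: norm_divide norm_mult norm_power)
  also have "\<dots> \<le> (a k)\<^sup>2 * (B' * (1 / 2) ^ j) / (norm w * norm w')"
    by (intro divide_right_mono mult_left_mono IH) auto
  also have "\<dots> = (a k)\<^sup>2 * B' / (norm w * norm w') * (1 / 2) ^ j"
    by simp
  also have "\<dots> \<le> B / 2 * (1 / 2) ^ j"
    using key nz by (intro mult_right_mono) (auto simp: divide_le_eq)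
  finally show ?case
    by (simp add: B_def)
qed

definition jacobi_tail :: "(nat \<Rightarrow> real) \<Rightarrow> (nat \<Rightarrow> real) \<Rightarrow> nat \<Rightarrow> complex \<Rightarrow> complex" where
  "jacobi_tail a b k z = lim (\<lambda>j. jacobi_denom a b j k z)"

lemma jacobi_denom_tendsto:
  assumes "dominated a b m z" "m \<le> k"
  shows "(\<lambda>j. jacobi_denom a b j k z) \<longlonglongrightarrow> jacobi_tail a b k z"
proof -
  define B where "B = norm (z - of_real (b k))"
  have B: "B > 0" unfolding B_def by (rule dominated_pos[OF assms])
  have "Cauchy (\<lambda>j. jacobi_denom a b j k z)"
  proof (rule CauchyI')
    fix \<epsilon> :: real assume "\<epsilon> > 0"
    then obtain J where J: "(1 / 2 :: real) ^ J < \<epsilon> / B"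
      using real_arch_pow_inv[of "\<epsilon> / B" "1 / 2"] B by auto
    show "\<exists>M. \<forall>i\<ge>M. \<forall>j>i. dist (jacobi_denom a b i k z) (jacobi_denom a b j k z) < \<epsilon>"
    proof (intro exI[of _ J] allI impI)
      fix i j assume ij: "J \<le> i" "i < j"
      have "dist (jacobi_denom a b i k z) (jacobi_denom a b j k z) \<le> B * (1 / 2) ^ i"
        using jacobi_denom_diff[OF assms, of i "j - i"] ij by (simp add: dist_norm norm_minus_commute B_def)
      also have "\<dots> \<le> B * (1 / 2) ^ J"
        using B ij by (intro mult_left_mono power_decreasing) auto
      also have "\<dots> < \<epsilon>"
        using J B by (simp add: field_simps)
      finally show "dist (jacobi_denom a b i k z) (jacobi_denom a b j k z) < \<epsilon>" .
    qed
  qed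
  then show ?thesis
    by (simp add: Cauchy_convergent_iff convergent_LIMSEQ_iff jacobi_tail_def)
qed

lemma jacobi_tail_diff:
  assumes "dominated a b m z" "m \<le> k"
  shows "norm (jacobi_tail a b k z - jacobi_denom a b j k z) \<le> norm (z - of_real (b k)) * (1 / 2) ^ j"
proof -
  have "(\<lambda>p. norm (jacobi_denom a b (p + j) k z - jacobi_denom a b j k z))
          \<longlonglongrightarrow> norm (jacobi_tail a b k z - jacobi_denom a b j k z)"
    by (intro tendsto_intros LIMSEQ_ignore_initial_segment jacobi_denom_tendsto[OF assms])
  then show ?thesis
    using jacobi_denom_diff[OF assms, of j] by (intro LIMSEQ_le_const2) (auto simp: add.commute)
qed

lemma jacobi_tail_lower_bound:
  assumes "dominated a b m z" "m \<le> k"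
  shows "norm (z - of_real (b k)) / 2 \<le> norm (jacobi_tail a b k z)"
  using tendsto_norm[OF jacobi_denom_tendsto[OF assms]] jacobi_denom_lower_bound[OF assms]
  by (intro LIMSEQ_le_const) auto

lemma jacobi_tail_nonzero:
  assumes "dominated a b m z" "m \<le> k"
  shows "jacobi_tail a b k z \<noteq> 0"
  using jacobi_tail_lower_bound[OF assms] dominated_pos[OF assms] by auto

lemma jacobi_tail_rec:
  assumes "dominated a b m z" "m \<le> k"
  shows "jacobi_tail a b k z = z - of_real (b k) - (of_real (a k))\<^sup>2 / jacobi_tail a b (Suc k) z"
proof -
  have "(\<lambda>j. jacobi_denom a b (Suc j) k z)
      \<longlonglongrightarrow> z - of_real (b k) - (of_real (a k))\<^sup>2 / jacobi_tail a b (Suc k) z"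
    unfolding jacobi_denom.simps using assms
    by (intro tendsto_intros jacobi_denom_tendsto[OF assms(1)] jacobi_tail_nonzero[OF assms(1)]) auto
  moreover have "(\<lambda>j. jacobi_denom a b (Suc j) k z) \<longlonglongrightarrow> jacobi_tail a b k z"
    using jacobi_denom_tendsto[OF assms] by (rule LIMSEQ_Suc)
  ultimately show ?thesis
    using LIMSEQ_unique by blast
qed

text \<open>The geometric error carries the scale \<open>norm (z - b k)\<close>, which is at most
  \<open>R + \<bar>b k\<bar>\<close> on a set bounded by \<open>R\<close>.\<close>

lemma jacobi_denom_uniform_limit:
  assumes "\<And>z. z \<in> S \<Longrightarrow> dominated a b m z" "m \<le> k" "bounded S"
  shows "uniform_limit S (\<lambda>j. jacobi_denom a b j k) (jacobi_tail a b k) sequentially"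
proof (rule uniform_limitI)
  fix \<epsilon> :: real assume "\<epsilon> > 0"
  obtain R where R: "R > 0" "\<And>z. z \<in> S \<Longrightarrow> norm z \<le> R"
    using assms(3) by (auto simp: bounded_pos)
  define B where "B = R + \<bar>b k\<bar>"
  have B: "B > 0" "norm (z - of_real (b k)) \<le> B" if "z \<in> S" for z
    using R norm_triangle_ineq4[of z "of_real (b k)"] that by (fastforce simp: B_def)+
  have "(\<lambda>j. B * (1 / 2 :: real) ^ j) \<longlonglongrightarrow> B * 0"
    by (intro tendsto_intros LIMSEQ_realpow_zero) auto
  then have "\<forall>\<^sub>F j in sequentially. B * (1 / 2) ^ j < \<epsilon>"
    using \<open>\<epsilon> > 0\<close> by (auto dest: order_tendstoD(2))
  then show "\<forall>\<^sub>F j in sequentially. \<forall>z\<in>S. dist (jacobi_denom a b j k z) (jacobi_tail a b k z) < \<epsilon>"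
  proof eventually_elim
    case (elim j)
    show ?case
    proof
      fix z assume z: "z \<in> S"
      have "dist (jacobi_denom a b j k z) (jacobi_tail a b k z) \<le> norm (z - of_real (b k)) * (1 / 2) ^ j"
        using jacobi_tail_diff[OF assms(1)[OF z] assms(2)] by (simp add: dist_norm norm_minus_commute)
      also have "\<dots> \<le> B * (1 / 2) ^ j"
        by (intro mult_right_mono B(2)[OF z]) auto
      finally show "dist (jacobi_denom a b j k z) (jacobi_tail a b k z) < \<epsilon>"
        using elim by simp
    qed
  qed
qed

lemma Im_jacobi_denom: "Im z > 0 \<Longrightarrow> Im (jacobi_denom a b j k z) \<ge> Im z"
proof (induction j arbitrary: k)
  case (Suc j)
  then have "Im ((of_real (a k))\<^sup>2 / jacobi_denom a b j (Suc k) z) \<le> 0"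
    by (intro Im_square_divide_nonpos) (meson less_imp_le order_trans)
  then show ?case by simp
qed simp

text \<open>Later this ensures that the limiting denominator \<open>U\<close> does not vanish
  identically on a disc.\<close>

lemma Im_jacobi_tail:
  assumes "dominated a b m z" "m \<le> k" "Im z > 0"
  shows "Im (jacobi_tail a b k z) \<ge> Im z"
  using tendsto_Im[OF jacobi_denom_tendsto[OF assms(1,2)]] Im_jacobi_denom[OF assms(3)]
  by (intro LIMSEQ_le_const) auto

lemma holomorphic_jacobi_denom:
  assumes "\<And>z. z \<in> S \<Longrightarrow> dominated a b m z" "m \<le> k"
  shows "jacobi_denom a b j k holomorphic_on S"
  using assms(2)
proof (induction j arbitrary: k)
  case 0
  have "(\<lambda>z. z - of_real (b k)) holomorphic_on S" by (intro holomorphic_intros)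
  then show ?case by (simp cong: holomorphic_cong)
next
  case (Suc j)
  have "(\<lambda>z. z - of_real (b k) - (of_real (a k))\<^sup>2 / jacobi_denom a b j (Suc k) z) holomorphic_on S"
    using Suc jacobi_denom_nonzero[OF assms(1)]
    by (intro holomorphic_intros) (auto simp: eta_contract_eq)
  then show ?case by (simp cong: holomorphic_cong)
qed

text \<open>The continuant telescopes into a product of nonzero \<open>jacobi_denom\<close> values.
  Strong induction supplies the shorter blocks that the ratio formula asks for.\<close>

lemma dominated_continuant_nonzero:
  assumes "dominated a b m z" "m \<le> k"
  shows "continuant a b n k z \<noteq> 0"
  using assms(2)
proof (induction n arbitrary: k rule: less_induct)
  case (less n)
  show ?case
  proof (cases n)
    case (Suc j)
    have "continuant a b (Suc j) k z = jacobi_denom a b j k z * continuant a b j (Suc k) z"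
      by (rule continuant_Suc_eq_jacobi_denom) (use less Suc in auto)
    then show ?thesis
      using less Suc jacobi_denom_nonzero[OF assms(1)] by auto
  qed simp
qed

section \<open>Continuants closed off by a tail\<close>

text \<open>
  The continuant of the block \<open>k, \<dots>, k + p\<close> with \<open>w\<close> as the tail of the continued fraction from
  index \<open>k + p + 1\<close> on.
\<close>

definition closed_continuant ::
  "(nat \<Rightarrow> real) \<Rightarrow> (nat \<Rightarrow> real) \<Rightarrow> nat \<Rightarrow> nat \<Rightarrow> complex \<Rightarrow> complex \<Rightarrow> complex" where
  "closed_continuant a b p k w z =
     continuant a b (Suc p) k z - (of_real (a (k + p)))\<^sup>2 * continuant a b p k z / w"

text \<open>Split the block and pull out the continuant of its right part. Numerator and denominator
  of an approximant share this factor, so after cancellation \<open>j\<close> enters only through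
  \<open>jacobi_denom\<close>.\<close>

lemma continuant_eq_closed_continuant:
  assumes "dominated a b (Suc (k + p)) z"
  shows "continuant a b (Suc (p + Suc j)) k z =
    closed_continuant a b p k (jacobi_denom a b j (Suc (k + p)) z) z
      * continuant a b (Suc j) (Suc (k + p)) z"
proof -
  have "continuant a b (Suc j) (Suc (k + p)) z =
      jacobi_denom a b j (Suc (k + p)) z * continuant a b j (Suc (Suc (k + p))) z"
    by (rule continuant_Suc_eq_jacobi_denom) (auto intro!: dominated_continuant_nonzero[OF assms])
  moreover have "jacobi_denom a b j (Suc (k + p)) z \<noteq> 0"
    by (rule jacobi_denom_nonzero[OF assms]) auto
  ultimately show ?thesis
    by (simp only: continuant_split closed_continuant_def) (simp add: field_simps)
qed

text \<open>Up to a nonzero continuant this is \<open>q - a^2 / w\<close>, where \<open>q\<close>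
  has positive imaginary part and \<open>- a^2 / w\<close> a nonnegative one.\<close>

lemma closed_continuant_upper_half_plane:
  assumes "Im z > 0" "Im w \<ge> 0"
  shows "closed_continuant a b p k w z \<noteq> 0"
proof -
  define q where "q = continuant a b (Suc p) k z / continuant a b p k z"
  have c: "continuant a b p k z \<noteq> 0" "Im q \<ge> Im z"
    using continuant_upper_half_plane[OF assms(1)] by (auto simp: q_def)
  have "Im (q - (of_real (a (k + p)))\<^sup>2 / w) > 0"
    using Im_square_divide_nonpos[OF assms(2), of "a (k + p)"] c(2) assms(1) by simp
  then have "q - (of_real (a (k + p)))\<^sup>2 / w \<noteq> 0"
    by (metis less_irrefl zero_complex.sel(2))
  moreover have "closed_continuant a b p k w z =
      continuant a b p k z * (q - (of_real (a (k + p)))\<^sup>2 / w)"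
    using c by (simp add: closed_continuant_def q_def field_simps)
  ultimately show ?thesis
    using c by simp
qed

lemma closed_continuant_uniform_limit:
  assumes "\<And>z. z \<in> cball 0 R \<Longrightarrow> dominated a b m z"
  shows "uniform_limit (cball 0 R) (\<lambda>j z. closed_continuant a b p k (jacobi_denom a b j m z) z)
           (\<lambda>z. closed_continuant a b p k (jacobi_tail a b m z) z) sequentially"
proof -
  define F where "F z = (of_real (a (k + p)))\<^sup>2 * continuant a b p k z" for z
  have "F holomorphic_on UNIV"
    unfolding F_def by (intro holomorphic_intros)
  then have "continuous_on (cball 0 R) F"
    by (meson continuous_on_subset holomorphic_on_imp_continuous_on subset_UNIV)
  then have bdd: "bounded (F ` cball 0 R)"
    by (intro compact_imp_bounded compact_continuous_image) auto
  \<comment> \<open>The bound is independent of \<open>z\<close>, as uniform convergence of the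
    quotients requires.\<close>
  have lb: "2 * a m \<le> norm (jacobi_tail a b m z)" if "z \<in> cball 0 R" for z
    using dominatedD[OF assms[OF that] order_refl] jacobi_tail_lower_bound[OF assms[OF that] order_refl]
    by linarith
  show ?thesis
  \<comment> \<open>Positivity of \<open>a m\<close> is read off from \<open>dominated\<close> at
    some point, so the disc must be nonempty.\<close>
  proof (cases "cball (0::complex) R = {}")
    case True
    then show ?thesis by simp
  next
    case False
    then obtain z0 :: complex where "z0 \<in> cball 0 R" by blast
    then have "a m > 0" using dominatedD(1)[OF assms] by blast
    then have "uniform_limit (cball 0 R) (\<lambda>j z. F z / jacobi_denom a b j m z)
        (\<lambda>z. F z / jacobi_tail a b m z) sequentially"
      by (intro uniform_lim_divide[where b = "2 * a m"] bdd lb uniform_limit_const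
          jacobi_denom_uniform_limit[where m = m] assms) auto
    then show ?thesis
      unfolding closed_continuant_def F_def
      by (intro uniform_limit_intros)
  qed
qed

text \<open>By the Weierstrass theorem, the uniform limit \<open>jacobi_tail\<close> of holomorphic
  functions is holomorphic inside the disc.\<close>

lemma holomorphic_closed_continuant_tail:
  assumes "\<And>z. z \<in> cball 0 R \<Longrightarrow> dominated a b m z"
  shows "(\<lambda>z. closed_continuant a b p k (jacobi_tail a b m z) z) holomorphic_on ball 0 R"
proof -
  have "jacobi_denom a b j m holomorphic_on cball 0 R" for j
    by (intro holomorphic_jacobi_denom[where m = m] assms) auto
  then have "continuous_on (cball 0 R) (jacobi_denom a b j m)"
      "jacobi_denom a b j m holomorphic_on ball 0 R" for j
    using holomorphic_on_imp_continuous_on holomorphic_on_subset ball_subset_cball by metis+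
  moreover have "uniform_limit (cball 0 R) (\<lambda>j. jacobi_denom a b j m) (jacobi_tail a b m) sequentially"
    by (intro jacobi_denom_uniform_limit[where m = m] assms) auto
  ultimately have "jacobi_tail a b m holomorphic_on ball 0 R"
    using holomorphic_uniform_limit[where f = "\<lambda>j. jacobi_denom a b j m" and g = "jacobi_tail a b m"
        and F = sequentially and z = 0 and r = R] by auto
  moreover have "jacobi_tail a b m z \<noteq> 0" if "z \<in> ball 0 R" for z
    using that by (intro jacobi_tail_nonzero[OF assms]) auto
  ultimately show ?thesis
    unfolding closed_continuant_def by (intro holomorphic_intros) (auto simp: eta_contract_eq)
qed


section \<open>Eigenvectors\<close>

lemma cinner_scaleC_right: "cinner x (c *\<^sub>C y) = cnj c * cinner x y"
  by (metis cinner_commute cinner_scaleC_left complex_cnj_mult)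

lemma cinner_add_right: "cinner x (y + z) = cinner x y + cinner x z"
  by (metis cinner_commute cinner_add_left complex_cnj_add)

lemma norm_scaleC: "norm (c *\<^sub>C x) = norm c * norm x"
proof -
  have "of_real ((norm (c *\<^sub>C x))\<^sup>2) = c * cnj c * of_real ((norm x)\<^sup>2)"
    by (simp only: cinner_self[symmetric] cinner_scaleC_left cinner_scaleC_right mult.assoc mult.left_commute)
  also have "\<dots> = of_real ((norm c * norm x)\<^sup>2)"
    by (simp only: complex_norm_square[symmetric] power_mult_distrib of_real_mult)
  finally have "(norm (c *\<^sub>C x))\<^sup>2 = (norm c * norm x)\<^sup>2"
    by (simp only: of_real_eq_iff)
  then show ?thesis
    by (simp add: power2_eq_iff_nonneg)
qed

lemma scaleC_zero_right: "c *\<^sub>C (0 :: 'a :: chilbert_space) = 0"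
  using norm_scaleC[of c 0] by simp

lemma tendsto_scaleC_right:
  assumes "(f \<longlongrightarrow> l) F"
  shows "((\<lambda>x. c *\<^sub>C f x) \<longlongrightarrow> c *\<^sub>C l) F"
proof -
  have "((\<lambda>x. norm c * norm (f x - l)) \<longlongrightarrow> norm c * 0) F"
    using assms by (intro tendsto_intros) (simp add: tendsto_norm_zero_iff Lim_null[symmetric])
  then have "((\<lambda>x. norm (c *\<^sub>C f x - c *\<^sub>C l)) \<longlongrightarrow> 0) F"
    by (simp add: norm_scaleC flip: complex_vector.scale_right_diff_distrib)
  then show ?thesis
    by (simp only: Lim_null[of _ "c *\<^sub>C l"] tendsto_norm_zero_iff)
qed

lemma orthonormal_basis_norm:
  assumes "orthonormal_basis e" "n \<ge> 1"
  shows "norm (e n) = 1"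
proof -
  have "cinner (e n) (e n) = 1"
    using assms by (simp add: orthonormal_basis_def)
  then have "(norm (e n))\<^sup>2 = 1"
    by (simp only: cinner_self of_real_eq_1_iff)
  then show ?thesis
    using norm_ge_zero[of "e n"] by (auto simp: power2_eq_1_iff)
qed

lemma norm_add_orthogonal_ge:
  assumes "cinner u v = 0"
  shows "norm u \<le> norm (u + v)"
proof -
  have "cinner v u = 0"
    by (subst cinner_commute) (simp only: assms complex_cnj_zero)
  then have "complex_of_real ((norm (u + v))\<^sup>2) = of_real ((norm u)\<^sup>2 + (norm v)\<^sup>2)"
    unfolding of_real_add cinner_self[symmetric] cinner_add_left cinner_add_right
    by (simp only: assms add_0_left add_0_right)
  then have "(norm (u + v))\<^sup>2 = (norm u)\<^sup>2 + (norm v)\<^sup>2"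
    by (simp only: of_real_eq_iff)
  then have "(norm u)\<^sup>2 \<le> (norm (u + v))\<^sup>2"
    by (simp only: le_add_same_cancel1 zero_le_power2)
  then show ?thesis
    by (rule power2_le_imp_le) (rule norm_ge_zero)
qed

text \<open>Appending orthogonal terms never shrinks the norm. In the limit this shows that the
  eigenvector is nonzero.\<close>

lemma norm_partial_sum_ge:
  assumes "orthonormal_basis e" "n \<ge> 1"
  shows "norm (x 1) \<le> norm (\<Sum>k=1..n. x k *\<^sub>C e k)"
  using assms(2)
proof (induction n rule: dec_induct)
  case base
  then show ?case
    using orthonormal_basis_norm[OF assms(1), of 1] by (simp add: norm_scaleC)
next
  case (step n)
  have orth: "cinner (\<Sum>k=1..i. x k *\<^sub>C e k) (e j) = 0" if "i < j" for i j
    using that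
  proof (induction i)
    case 0
    show ?case
      using cinner_add_left[of 0 0 "e j"] by simp
  next
    case (Suc i)
    then show ?case
      using assms(1) by (simp add: cinner_add_left cinner_scaleC_left orthonormal_basis_def)
  qed
  have "norm (\<Sum>k=1..n. x k *\<^sub>C e k) \<le> norm ((\<Sum>k=1..n. x k *\<^sub>C e k) + x (Suc n) *\<^sub>C e (Suc n))"
    by (intro norm_add_orthogonal_ge) (simp only: cinner_scaleC_right orth lessI mult_zero_right)
  also have "\<dots> = norm (\<Sum>k=1..Suc n. x k *\<^sub>C e k)"
    by (simp add: sum.cl_ivl_Suc)
  finally show ?case
    by (rule order_trans[OF step.IH])
qed

text \<open>The recurrence settles all rows except those at the cut: row \<open>n\<close> lacks
  \<open>a n * x (Suc n)\<close>, and row \<open>Suc n\<close> receives \<open>a n * x n\<close>.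
  The conventions \<open>e 0 = 0\<close> and \<open>x 0 = 0\<close> remove the terms with
  \<open>a 0\<close>.\<close>

lemma sum_jacobi_vec:
  assumes "e 0 = 0" "x 0 = 0"
    and rec: "\<And>n. of_real (a n) * x n + of_real (b (Suc n)) * x (Suc n)
                  + of_real (a (Suc n)) * x (Suc (Suc n)) = l * x (Suc n)"
  shows "(\<Sum>k=1..n. x k *\<^sub>C jacobi_vec e a b k) =
    l *\<^sub>C (\<Sum>k=1..n. x k *\<^sub>C e k) - (of_real (a n) * x (Suc n)) *\<^sub>C e n
    + (of_real (a n) * x n) *\<^sub>C e (Suc n)"
proof (induction n)
  case 0
  show ?case
    using assms by (simp add: scaleC_zero_right)
next
  case (Suc n)
  have l: "l * x (Suc n) = of_real (a n) * x n + of_real (b (Suc n)) * x (Suc n)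
                  + of_real (a (Suc n)) * x (Suc (Suc n))"
    by (rule rec[symmetric])
  have "x (Suc n) *\<^sub>C jacobi_vec e a b (Suc n) =
      (of_real (a (Suc n)) * x (Suc n)) *\<^sub>C e (Suc (Suc n))
      + (of_real (b (Suc n)) * x (Suc n)) *\<^sub>C e (Suc n) + (of_real (a n) * x (Suc n)) *\<^sub>C e n"
    by (simp add: jacobi_vec_def scaleC_add_right scaleC_scaleC mult.commute flip: scaleC_of_real)
  moreover have "(\<Sum>k=1..Suc n. x k *\<^sub>C jacobi_vec e a b k) =
      (\<Sum>k=1..n. x k *\<^sub>C jacobi_vec e a b k) + x (Suc n) *\<^sub>C jacobi_vec e a b (Suc n)"
    by simp
  moreover have "l *\<^sub>C (\<Sum>k=1..Suc n. x k *\<^sub>C e k) = l *\<^sub>C (\<Sum>k=1..n. x k *\<^sub>C e k)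
      + (of_real (a n) * x n) *\<^sub>C e (Suc n) + (of_real (b (Suc n)) * x (Suc n)) *\<^sub>C e (Suc n)
      + (of_real (a (Suc n)) * x (Suc (Suc n))) *\<^sub>C e (Suc n)"
    by (simp add: scaleC_add_right scaleC_scaleC l scaleC_add_left)
  ultimately show ?case
    by (simp only: Suc.IH) (simp only: algebra_simps)
qed

text \<open>
  \<open>T\<close> maps a truncated eigenvector to its multiple up to two terms at the cut, whose coefficients
  vanish in the limit by the boundary assumptions.
\<close>

lemma jacobi_operator_eigenvalueI:
  fixes e :: "nat \<Rightarrow> 'a::chilbert_space"
  assumes e: "orthonormal_basis e" "e 0 = 0"
    and x: "x 0 = 0" "x 1 \<noteq> 0"
    and rec: "\<And>n. of_real (a n) * x n + of_real (b (Suc n)) * x (Suc n)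
                  + of_real (a (Suc n)) * x (Suc (Suc n)) = l * x (Suc n)"
    and summable: "summable (\<lambda>n. norm (x n))"
    and boundary: "(\<lambda>n. of_real (a n) * x (Suc n)) \<longlonglongrightarrow> 0" "(\<lambda>n. of_real (a n) * x n) \<longlonglongrightarrow> 0"
  shows "l \<in> eigenvalues (jacobi_operator e a b)"
proof -
  define S where "S n = (\<Sum>k=1..n. x k *\<^sub>C e k)" for n
  define TS where "TS n = (\<Sum>k=1..n. x k *\<^sub>C jacobi_vec e a b k)" for n
  have norm_e: "norm (e n) \<le> 1" for n
    using orthonormal_basis_norm[OF e(1), of n] e(2) by (cases n) auto
  have small: "(\<lambda>n. c n *\<^sub>C e (g n)) \<longlonglongrightarrow> 0" if "c \<longlonglongrightarrow> 0" for c g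
  proof (rule tendsto_norm_zero_cancel, rule Lim_null_comparison)
    show "\<forall>\<^sub>F n in sequentially. norm (norm (c n *\<^sub>C e (g n))) \<le> norm (c n)"
      by (intro always_eventually allI) (simp add: norm_scaleC mult_left_le norm_e)
    show "(\<lambda>n. norm (c n)) \<longlonglongrightarrow> 0"
      using that by (rule tendsto_norm_zero)
  qed
  have "summable (\<lambda>n. norm (x n *\<^sub>C e n))"
    by (rule summable_comparison_test[OF _ summable])
       (use norm_e in \<open>auto simp: norm_scaleC intro!: mult_left_le\<close>)
  then have "summable (\<lambda>n. x n *\<^sub>C e n)"
    by (rule summable_norm_cancel)
  then have "(\<lambda>n. \<Sum>k\<le>n. x k *\<^sub>C e k) \<longlonglongrightarrow> (\<Sum>n. x n *\<^sub>C e n)"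
    by (rule summable_LIMSEQ')
  moreover have "(\<Sum>k\<le>n. x k *\<^sub>C e k) = S n" for n
    unfolding S_def using x(1) by (intro sum.mono_neutral_right) (auto simp: Suc_le_eq)
  ultimately obtain s where s: "S \<longlonglongrightarrow> s"
    by auto
  have "TS n = l *\<^sub>C S n - (of_real (a n) * x (Suc n)) *\<^sub>C e n + (of_real (a n) * x n) *\<^sub>C e (Suc n)" for n
    unfolding TS_def S_def by (intro sum_jacobi_vec e x rec)
  moreover have "(\<lambda>n. l *\<^sub>C S n - (of_real (a n) * x (Suc n)) *\<^sub>C e n
      + (of_real (a n) * x n) *\<^sub>C e (Suc n)) \<longlonglongrightarrow> l *\<^sub>C s - 0 + 0"
    by (intro tendsto_add tendsto_diff tendsto_scaleC_right s small boundary)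
  ultimately have "(\<lambda>n. (S n, TS n)) \<longlonglongrightarrow> (s, l *\<^sub>C s)"
    by (intro tendsto_Pair s) simp
  moreover have "(S n, TS n) \<in> jacobi_span_operator e a b" for n
    unfolding jacobi_span_operator_def S_def TS_def
    by (intro CollectI exI[of _ "{1..n}"] exI[of _ x]) auto
  ultimately have "(s, l *\<^sub>C s) \<in> jacobi_operator e a b"
    unfolding jacobi_operator_def closure_sequential by (intro exI[of _ "\<lambda>n. (S n, TS n)"]) blast
  moreover have "norm (x 1) \<le> norm s"
  proof (rule LIMSEQ_le_const[OF tendsto_norm[OF s]])
    show "\<exists>N. \<forall>n\<ge>N. norm (x 1) \<le> norm (S n)"
      unfolding S_def using norm_partial_sum_ge[OF e(1)] by blast
  qed
  then have "s \<noteq> 0"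
    using x(2) by auto
  ultimately show ?thesis
    by (auto simp: eigenvalues_def)
qed

text \<open>A zero of the closed continuant is the matching condition under which the solution
  started at the left end continues as the decaying solution described by the tails.\<close>

lemma closed_continuant_zero_imp_eigenvalue:
  fixes e :: "nat \<Rightarrow> 'a::chilbert_space"
  assumes e: "orthonormal_basis e" "e 0 = 0"
    and a: "\<And>n. n \<ge> 1 \<Longrightarrow> a n > 0"
    and dom: "dominated a b (Suc (Suc p)) z"
    and zero: "closed_continuant a b p 1 (jacobi_tail a b (Suc (Suc p)) z) z = 0"
  shows "z \<in> eigenvalues (jacobi_operator e a b)"
proof -
  define P where "P n = continuant a b n 1 z" for n
  define D where "D k = jacobi_tail a b k z" for k
  define A where "A n = complex_of_real (\<Prod>j=1..n. a j)" for n
  \<comment> \<open>Dividing by \<open>a 1 * ... * a n\<close> turns the continuants into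
    orthonormal polynomials; the index is shifted so that \<open>x 1 = 1\<close>.\<close>
  define x where "x k = (case k of 0 \<Rightarrow> 0 | Suc n \<Rightarrow> P n / A n)" for k
  have A_Suc: "A (Suc n) = A n * of_real (a (Suc n))" and A_nz: "A n \<noteq> 0" for n
    using a by (auto simp: A_def prod_zero_iff) (metis less_irrefl)
  have a_nz: "complex_of_real (a (Suc n)) \<noteq> 0" for n
    using a[of "Suc n"] by simp
  have D_nz: "D (Suc (Suc n)) \<noteq> 0" if "n \<ge> p" for n
    using that unfolding D_def by (intro jacobi_tail_nonzero[OF dom]) auto
  have P_Suc: "P (Suc (Suc n)) = (z - of_real (b (Suc (Suc n)))) * P (Suc n) - (of_real (a (Suc n)))\<^sup>2 * P n" for n
    using continuant_Suc_right[of a b n 1 z] by (simp add: P_def)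
  \<comment> \<open>The case \<open>n = p\<close> is the assumed zero; the recurrences of
    \<open>P\<close> and of the tails carry it on to all larger \<open>n\<close>.\<close>
  have P_D: "P (Suc n) * D (Suc (Suc n)) = (of_real (a (Suc n)))\<^sup>2 * P n" if "n \<ge> p" for n
    using that
  proof (induction n rule: dec_induct)
    case base
    then show ?case
      using zero D_nz[of p] by (simp add: closed_continuant_def P_def D_def field_simps)
  next
    case (step n)
    have "D (Suc (Suc n)) = z - of_real (b (Suc (Suc n))) - (of_real (a (Suc (Suc n))))\<^sup>2 / D (Suc (Suc (Suc n)))"
      unfolding D_def using step by (intro jacobi_tail_rec[OF dom]) auto
    moreover have "P (Suc (Suc n)) = (z - of_real (b (Suc (Suc n))) - D (Suc (Suc n))) * P (Suc n)"
      using step.IH by (simp add: P_Suc algebra_simps)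
    ultimately show ?case
      using D_nz[of "Suc n"] step by simp
  qed
  have ratio: "x (Suc (Suc n)) = of_real (a (Suc n)) / D (Suc (Suc n)) * x (Suc n)" if "n \<ge> p" for n
  proof -
    have "P (Suc n) = (of_real (a (Suc n)))\<^sup>2 * P n / D (Suc (Suc n))"
      using P_D[OF that] D_nz[OF that] by (simp add: field_simps)
    then show ?thesis
      using a_nz[of n] A_nz[of n] D_nz[OF that] by (simp add: x_def A_Suc power2_eq_square)
  qed
  \<comment> \<open>Each tail dominates the coefficients on both sides: \<open>D_lb\<close> yields
    the decay of \<open>a n * x n\<close>, and \<open>D_lb'\<close> that of \<open>x n\<close>. The
    latter uses domination one index earlier, hence \<open>n \<ge> Suc p\<close>.\<close>
  have D_lb: "2 * a (Suc (Suc n)) \<le> norm (D (Suc (Suc n)))" if "n \<ge> p" for n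
    using jacobi_tail_lower_bound[OF dom, of "Suc (Suc n)"] dominatedD[OF dom, of "Suc (Suc n)"] that
    unfolding D_def by force
  have D_lb': "2 * a (Suc n) \<le> norm (D (Suc (Suc n)))" if "n \<ge> Suc p" for n
    using jacobi_tail_lower_bound[OF dom, of "Suc (Suc n)"] dominatedD[OF dom, of "Suc n"] that
    unfolding D_def by force
  have half: "norm (of_real t / D k) \<le> 1 / 2" if "2 * t \<le> norm (D k)" "t > 0" for t k
    using that by (simp add: norm_divide divide_le_eq)
  have x_half: "norm (x (Suc n)) \<le> 1 / 2 * norm (x n)" if le: "n \<ge> Suc (Suc p)" for n
  proof -
    obtain n' where n': "n = Suc n'" "n' \<ge> Suc p" using le by (cases n) auto
    have "norm (x (Suc n)) = norm (of_real (a n) / D (Suc n)) * norm (x n)"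
      using n' by (simp add: ratio norm_mult norm_divide)
    also have "\<dots> \<le> 1 / 2 * norm (x n)"
      using D_lb'[OF n'(2)] a[of n] n' by (intro mult_right_mono half) auto
    finally show ?thesis .
  qed
  have ax_half: "norm (of_real (a (Suc n)) * x (Suc n)) \<le> 1 / 2 * norm (of_real (a n) * x n)"
    if le: "n \<ge> Suc (Suc p)" for n
  proof -
    obtain n' where n': "n = Suc n'" "n' \<ge> p" using le by (cases n) auto
    have "norm (of_real (a (Suc n)) * x (Suc n)) = norm (of_real (a (Suc n)) / D (Suc n)) * norm (of_real (a n) * x n)"
      using n' by (simp add: ratio norm_mult norm_divide)
    also have "\<dots> \<le> 1 / 2 * norm (of_real (a n) * x n)"
      using D_lb[OF n'(2)] a[of "Suc n"] n' by (intro mult_right_mono half) auto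
    finally show ?thesis .
  qed
  have ax0: "(\<lambda>n. of_real (a n) * x n) \<longlonglongrightarrow> 0"
    by (rule summable_LIMSEQ_zero, rule summable_ratio_test[where c = "1 / 2" and N = "Suc (Suc p)"])
       (use ax_half in auto)
  show ?thesis
  proof (rule jacobi_operator_eigenvalueI[OF e])
    show "x 0 = 0" "x 1 \<noteq> 0"
      by (auto simp: x_def P_def A_def)
    show "of_real (a n) * x n + of_real (b (Suc n)) * x (Suc n)
        + of_real (a (Suc n)) * x (Suc (Suc n)) = z * x (Suc n)" for n
    proof (cases n)
      case 0
      then show ?thesis
        using a_nz[of 0] by (simp add: x_def P_def A_def field_simps)
    next
      case (Suc n')
      then show ?thesis
        using a_nz[of n] a_nz[of n'] A_nz[of n'] P_Suc[of n']
        by (simp add: x_def A_Suc field_simps power2_eq_square)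
    qed
    show "summable (\<lambda>n. norm (x n))"
      by (rule summable_ratio_test[where c = "1 / 2" and N = "Suc (Suc p)"]) (use x_half in auto)
    show "(\<lambda>n. of_real (a n) * x n) \<longlonglongrightarrow> 0"
      by (fact ax0)
    show "(\<lambda>n. of_real (a n) * x (Suc n)) \<longlonglongrightarrow> 0"
    proof (rule Lim_null_comparison)
      show "\<forall>\<^sub>F n in sequentially. norm (of_real (a n) * x (Suc n)) \<le> norm (of_real (a n) * x n)"
        unfolding eventually_sequentially
      proof (intro exI[of _ "Suc (Suc p)"] allI impI)
        fix n assume n: "n \<ge> Suc (Suc p)"
        show "norm (of_real (a n) * x (Suc n)) \<le> norm (of_real (a n) * x n)"
          unfolding norm_mult using x_half[OF n] norm_ge_zero[of "x n"]
          by (intro mult_left_mono norm_ge_zero) linarith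
      qed
      show "(\<lambda>n. norm (of_real (a n) * x n)) \<longlonglongrightarrow> 0"
        using ax0 by (rule tendsto_norm_zero)
    qed
  qed
qed


section \<open>Convergence of the continued fraction\<close>

text \<open>If \<open>2 * R \<le> \<bar>b n\<bar>\<close>, then \<open>norm (z - b n)\<close> is at
  least \<open>\<bar>b n\<bar> / 2\<close> on the disc, so ratios below 1/8 suffice for the factor
  4. The index has the form \<open>q + 3\<close> so that nonempty blocks starting at 1 and at 2 both
  end just before it.\<close>

lemma eventually_dominated:
  fixes R :: real
  assumes a: "\<And>n. n \<ge> 1 \<Longrightarrow> a n > 0"
    and b: "filterlim (\<lambda>n. \<bar>b n\<bar>) at_top sequentially"
    and ratio: "(\<lambda>n. a n / \<bar>b n\<bar>) \<longlonglongrightarrow> 0" "(\<lambda>n. a (n - 1) / \<bar>b n\<bar>) \<longlonglongrightarrow> 0"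
  obtains q where "\<And>z. z \<in> cball 0 R \<Longrightarrow> dominated a b (q + 3) z"
proof -
  have "\<forall>\<^sub>F n in sequentially. a n / \<bar>b n\<bar> < 1 / 8" "\<forall>\<^sub>F n in sequentially. a (n - 1) / \<bar>b n\<bar> < 1 / 8"
    using ratio by (auto dest: order_tendstoD(2)[where a = "1 / 8"])
  moreover have "\<forall>\<^sub>F n in sequentially. \<bar>b n\<bar> \<ge> max 1 (2 * R)"
    using b by (simp only: filterlim_at_top)
  ultimately have "\<forall>\<^sub>F n in sequentially. 8 * a n \<le> \<bar>b n\<bar> \<and> 8 * a (n - 1) \<le> \<bar>b n\<bar> \<and> 2 * R \<le> \<bar>b n\<bar>"
    by eventually_elim (auto simp: divide_less_eq split: if_splits)
  then obtain q where q: "\<And>n. n \<ge> q \<Longrightarrow> 8 * a n \<le> \<bar>b n\<bar> \<and> 8 * a (n - 1) \<le> \<bar>b n\<bar> \<and> 2 * R \<le> \<bar>b n\<bar>"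
    by (auto simp: eventually_sequentially)
  have "dominated a b (q + 3) z" if "z \<in> cball 0 R" for z
  proof -
    have half: "\<bar>b n\<bar> / 2 \<le> norm (z - of_real (b n))" if "n \<ge> q" for n
      using q[OF that] norm_triangle_ineq2[of "of_real (b n)" z] \<open>z \<in> cball 0 R\<close>
      by (simp add: norm_minus_commute)
    show ?thesis
      unfolding dominated_def
    proof (intro allI impI conjI)
      fix k assume k: "q + 3 \<le> k"
      show "0 < a k" using a k by auto
      show "4 * a k \<le> norm (z - of_real (b k))"
        using q[of k] half[of k] k by linarith
      show "4 * a k \<le> norm (z - of_real (b (Suc k)))"
        using q[of "Suc k"] half[of "Suc k"] k by simp
    qed
  qed
  then show thesis by (rule that)
qed

text \<open>Both continuants of the approximant are split before index \<open>q + 3\<close>, and the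
  common right factor cancels.\<close>

lemma jacobi_approximant_eq_quotient:
  assumes "dominated a b (q + 3) z"
    and "closed_continuant a b (Suc q) 1 (jacobi_denom a b j (q + 3) z) z \<noteq> 0"
  shows "jacobi_approximant a b (j + (q + 3)) z =
      closed_continuant a b q 2 (jacobi_denom a b j (q + 3) z) z /
      closed_continuant a b (Suc q) 1 (jacobi_denom a b j (q + 3) z) z"
    and "\<not> is_pole (jacobi_approximant a b (j + (q + 3))) z"
proof -
  have ix: "Suc (2 + q) = q + 3" "Suc (1 + Suc q) = q + 3" "Suc (Suc q + Suc j) = j + (q + 3)"
    "Suc (Suc (q + Suc j)) = j + (q + 3)"
    by auto
  have nz: "continuant a b (Suc j) (q + 3) z \<noteq> 0"
    using assms(1) by (rule dominated_continuant_nonzero) auto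
  have num: "continuant a b (Suc (q + Suc j)) 2 z =
      closed_continuant a b q 2 (jacobi_denom a b j (q + 3) z) z * continuant a b (Suc j) (q + 3) z"
    using continuant_eq_closed_continuant[of a b 2 q z j] assms(1) by (simp only: ix)
  have den: "continuant a b (Suc (Suc (q + Suc j))) 1 z =
      closed_continuant a b (Suc q) 1 (jacobi_denom a b j (q + 3) z) z * continuant a b (Suc j) (q + 3) z"
    using continuant_eq_closed_continuant[of a b 1 "Suc q" z j] assms(1) by (simp only: ix)
  have "continuant a b (Suc (Suc (q + Suc j))) 1 z \<noteq> 0"
    using den nz assms(2) by simp
  note * = jacobi_approximant_eq[OF this]
  show "\<not> is_pole (jacobi_approximant a b (j + (q + 3))) z"
    using *(2) unfolding ix .
  show "jacobi_approximant a b (j + (q + 3)) z =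
      closed_continuant a b q 2 (jacobi_denom a b j (q + 3) z) z /
      closed_continuant a b (Suc q) 1 (jacobi_denom a b j (q + 3) z) z"
    using *(1) nz unfolding num den unfolding ix by simp
qed

lemma compact_norm_lower_bound:
  fixes f :: "'a::topological_space \<Rightarrow> 'b::real_normed_vector"
  assumes "compact C" "continuous_on C f" "\<And>x. x \<in> C \<Longrightarrow> f x \<noteq> 0"
  obtains c where "c > 0" "\<And>x. x \<in> C \<Longrightarrow> c \<le> norm (f x)"
proof (cases "C = {}")
  case False
  then obtain x0 where "x0 \<in> C" "\<forall>x\<in>C. norm (f x0) \<le> norm (f x)"
    using continuous_attains_inf[OF assms(1) _ continuous_on_norm[OF assms(2)]] by blast
  then show thesis
    using assms(3) by (intro that[of "norm (f x0)"]) auto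
qed (use that[of 1] in auto)

lemma jacobi_approximant_uniform_limit:
  defines "U \<equiv> \<lambda>a b q z. closed_continuant a b (Suc q) 1 (jacobi_tail a b (q + 3) z) z"
    and "V \<equiv> \<lambda>a b q z. closed_continuant a b q 2 (jacobi_tail a b (q + 3) z) z"
  assumes dom: "\<And>z. z \<in> cball 0 R \<Longrightarrow> dominated a b (q + 3) z"
    and C: "compact C" "C \<subseteq> ball 0 R" "\<And>z. z \<in> C \<Longrightarrow> U a b q z \<noteq> 0"
  shows "\<forall>\<^sub>F N in sequentially. \<forall>z\<in>C. \<not> is_pole (jacobi_approximant a b N) z"
    and "uniform_limit C (jacobi_approximant a b) (\<lambda>z. V a b q z / U a b q z) sequentially"
proof -
  define Uj where "Uj j z = closed_continuant a b (Suc q) 1 (jacobi_denom a b j (q + 3) z) z" for j z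
  define Vj where "Vj j z = closed_continuant a b q 2 (jacobi_denom a b j (q + 3) z) z" for j z
  have sub: "C \<subseteq> cball 0 R"
    using C(2) by auto
  have Uj: "uniform_limit C Uj (U a b q) sequentially"
    unfolding Uj_def U_def by (rule uniform_limit_on_subset[OF closed_continuant_uniform_limit[OF dom] sub])
  have Vj: "uniform_limit C Vj (V a b q) sequentially"
    unfolding Vj_def V_def by (rule uniform_limit_on_subset[OF closed_continuant_uniform_limit[OF dom] sub])
  have holo: "U a b q holomorphic_on ball 0 R" "V a b q holomorphic_on ball 0 R"
    unfolding U_def V_def by (intro holomorphic_closed_continuant_tail dom; assumption)+
  then have cont: "continuous_on C (U a b q)" "continuous_on C (V a b q)"
    using C(2) by (meson continuous_on_subset holomorphic_on_imp_continuous_on)+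
  obtain c where c: "c > 0" "\<And>z. z \<in> C \<Longrightarrow> c \<le> norm (U a b q z)"
    using compact_norm_lower_bound[OF C(1) cont(1) C(3)] by blast
  \<comment> \<open>Once \<open>Uj\<close> is within \<open>c\<close> of \<open>U\<close>, it cannot
    vanish, since \<open>norm (U a b q z) \<ge> c\<close> on \<open>C\<close>.\<close>
  have ev: "\<forall>\<^sub>F j in sequentially. \<forall>z\<in>C. Uj j z \<noteq> 0"
    using uniform_limitD[OF Uj c(1)]
    by eventually_elim (use c(2) in \<open>force simp: dist_norm\<close>)
  then have "\<forall>\<^sub>F j in sequentially. \<forall>z\<in>C. \<not> is_pole (jacobi_approximant a b (j + (q + 3))) z"
    by eventually_elim (use sub dom jacobi_approximant_eq_quotient(2) in \<open>auto simp: Uj_def\<close>)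
  then show "\<forall>\<^sub>F N in sequentially. \<forall>z\<in>C. \<not> is_pole (jacobi_approximant a b N) z"
    using eventually_sequentially_seg[of "\<lambda>N. \<forall>z\<in>C. \<not> is_pole (jacobi_approximant a b N) z"] by blast
  have eq: "\<forall>\<^sub>F j in sequentially. \<forall>z\<in>C. Vj j z / Uj j z = jacobi_approximant a b (j + (q + 3)) z"
    using ev
    by eventually_elim (use sub dom jacobi_approximant_eq_quotient(1) in \<open>auto simp: Uj_def Vj_def\<close>)
  have "bounded (V a b q ` C)"
    using cont(2) C(1) by (intro compact_imp_bounded compact_continuous_image)
  then have "uniform_limit C (\<lambda>j z. Vj j z / Uj j z) (\<lambda>z. V a b q z / U a b q z) sequentially"
    using c by (intro uniform_lim_divide[where b = c] Uj Vj) auto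
  then have "uniform_limit C (\<lambda>j. jacobi_approximant a b (j + (q + 3))) (\<lambda>z. V a b q z / U a b q z) sequentially"
    using uniform_limit_cong[OF eq] by blast
  then show "uniform_limit C (jacobi_approximant a b) (\<lambda>z. V a b q z / U a b q z) sequentially"
    unfolding uniform_limit_iff
    using eventually_sequentially_seg[of "\<lambda>N. \<forall>z\<in>C. dist (jacobi_approximant a b N z) (V a b q z / U a b q z) < \<epsilon>" for \<epsilon>]
    by blast
qed

theorem theorem6p1:
  fixes e :: "nat \<Rightarrow> 'a::chilbert_space"
    and a b :: "nat \<Rightarrow> real"
    and r :: real
  assumes "orthonormal_basis e"
    and "e 0 = 0"
    and "\<And>n. n \<ge> 1 \<Longrightarrow> a n > 0"
    and "filterlim (\<lambda>n. \<bar>b n\<bar>) at_top sequentially"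
    and "r < 1"
    and "(\<lambda>n. a n / \<bar>b n\<bar> powr r) \<longlonglongrightarrow> 0"
    and "(\<lambda>n. a (n - 1) / \<bar>b n\<bar> powr r) \<longlonglongrightarrow> 0"
  shows "\<exists>f. f nicely_meromorphic_on UNIV \<and>
    (\<forall>C. compact C \<and> C \<subseteq> UNIV - eigenvalues (jacobi_operator e a b) \<longrightarrow>
      (\<forall>\<^sub>F N in sequentially. \<forall>z\<in>C. \<not> is_pole (jacobi_approximant a b N) z) \<and>
      uniform_limit C (jacobi_approximant a b) f sequentially)"
proof -
  define U where "U q z = closed_continuant a b (Suc q) 1 (jacobi_tail a b (q + 3) z) z" for q z
  define V where "V q z = closed_continuant a b q 2 (jacobi_tail a b (q + 3) z) z" for q z
  \<comment> \<open>Here \<open>r < 1\<close> enters: multiplying by this null sequence turns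
    \<open>o(|b|^r)\<close> into \<open>o(|b|)\<close>.\<close>
  have powr0: "(\<lambda>n. \<bar>b n\<bar> powr (r - 1)) \<longlonglongrightarrow> 0"
    using assms(4,5) by (intro tendsto_neg_powr) auto
  \<comment> \<open>At \<open>b n = 0\<close> both sides are 0 by the conventions for
    \<open>powr\<close> and division.\<close>
  have powr_eq: "x / \<bar>b n\<bar> powr r * \<bar>b n\<bar> powr (r - 1) = x / \<bar>b n\<bar>" for x n
    by (cases "b n = 0") (auto simp: powr_diff)
  have ratio: "(\<lambda>n. a n / \<bar>b n\<bar>) \<longlonglongrightarrow> 0" "(\<lambda>n. a (n - 1) / \<bar>b n\<bar>) \<longlonglongrightarrow> 0"
    using tendsto_mult[OF assms(6) powr0] tendsto_mult[OF assms(7) powr0]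
    unfolding powr_eq mult_zero_left .
  have ex: "\<exists>q. \<forall>z\<in>cball 0 R. dominated a b (q + 3) z" for R
    by (rule eventually_dominated[OF assms(3,4) ratio, of R]) blast+
  \<comment> \<open>\<open>U q\<close> and \<open>V q\<close> depend on the disc, but the pointwise
    limit does not, so the local quotients need no gluing. Where \<open>lim\<close> is arbitrary, at
    isolated points, \<open>remove_sings\<close> repairs the value below.\<close>
  define g where "g z = lim (\<lambda>N. jacobi_approximant a b N z)" for z
  have g_eq: "g z = V q z / U q z"
    if "\<And>z. z \<in> cball 0 R \<Longrightarrow> dominated a b (q + 3) z" "z \<in> ball 0 R" "U q z \<noteq> 0" for R q z
  proof -
    have "uniform_limit {z} (jacobi_approximant a b) (\<lambda>z. V q z / U q z) sequentially"
      unfolding U_def V_def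
      by (rule jacobi_approximant_uniform_limit(2)[of R]) (use that in \<open>simp_all add: U_def\<close>)
    then have "(\<lambda>N. jacobi_approximant a b N z) \<longlonglongrightarrow> V q z / U q z"
      by (rule tendsto_uniform_limitI) simp
    then show ?thesis
      unfolding g_def by (rule limI)
  qed
  have holo: "U q holomorphic_on ball 0 R" "V q holomorphic_on ball 0 R"
    if "\<And>z. z \<in> cball 0 R \<Longrightarrow> dominated a b (q + 3) z" for q R
    unfolding U_def V_def by (rule holomorphic_closed_continuant_tail, erule that)+
  have g_ev: "\<forall>\<^sub>F w in at z. g w = V q w / U q w"
    if dom: "\<And>z. z \<in> cball 0 R \<Longrightarrow> dominated a b (q + 3) z" and z: "z \<in> ball 0 R" for R q z
  proof -
    have "norm z < R" using z by simp
    then have "R > 0" by (rule le_less_trans[OF norm_ge_zero])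
    \<comment> \<open>A point of the disc in the upper half plane: \<open>U q\<close> is nonzero
      there, so its zeros in the connected disc are isolated.\<close>
    then have i: "of_real (R / 2) * \<i> \<in> ball 0 R" by (simp add: norm_mult)
    have "U q (of_real (R / 2) * \<i>) \<noteq> 0"
      unfolding U_def
    proof (rule closed_continuant_upper_half_plane)
      show Im_pos: "Im (of_real (R / 2) * \<i>) > 0"
        using \<open>R > 0\<close> by simp
      have "dominated a b (q + 3) (of_real (R / 2) * \<i>)"
        using i ball_subset_cball by (intro dom) blast
      from Im_jacobi_tail[OF this order_refl Im_pos]
      show "Im (jacobi_tail a b (q + 3) (of_real (R / 2) * \<i>)) \<ge> 0"
        using Im_pos by linarith
    qed
    then have "\<forall>\<^sub>F w in at z. U q w \<noteq> 0 \<and> w \<in> ball 0 R"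
      using holo[OF dom] z i by (intro non_zero_neighbour_alt) auto
    then show ?thesis
      by eventually_elim (use g_eq[OF dom] in auto)
  qed
  define f where "f = remove_sings g"
  have "g meromorphic_on {z}" for z
  proof -
    obtain q where dom: "\<And>w. w \<in> cball 0 (norm z + 1) \<Longrightarrow> dominated a b (q + 3) w"
      using ex by blast
    have "U q analytic_on {z}" "V q analytic_on {z}"
      using holo[OF dom] by (auto simp: analytic_at intro!: exI[of _ "ball 0 (norm z + 1)"])
    then have "(\<lambda>w. V q w / U q w) meromorphic_on {z}"
      by (intro meromorphic_on_divide analytic_on_imp_meromorphic_on)
    moreover have "\<forall>\<^sub>F w in at z. g w = V q w / U q w"
      using dom by (intro g_ev[of "norm z + 1"]) auto
    ultimately show ?thesis
      using meromorphic_on_cong[of "{z}" g "\<lambda>w. V q w / U q w" "{z}"] by auto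
  qed
  then have "f nicely_meromorphic_on UNIV"
    unfolding f_def by (intro remove_sings_nicely_meromorphic) (subst meromorphic_on_meromorphic_at, blast)
  moreover have "(\<forall>\<^sub>F N in sequentially. \<forall>z\<in>C. \<not> is_pole (jacobi_approximant a b N) z) \<and>
      uniform_limit C (jacobi_approximant a b) f sequentially"
    if C: "compact C" "C \<subseteq> UNIV - eigenvalues (jacobi_operator e a b)" for C
  proof -
    obtain R where R: "C \<subseteq> ball 0 R"
      using bounded_subset_ballD[OF compact_imp_bounded[OF C(1)]] by blast
    obtain q where dom: "\<And>w. w \<in> cball 0 R \<Longrightarrow> dominated a b (q + 3) w"
      using ex by blast
    have nz: "U q z \<noteq> 0" if z: "z \<in> C" for z
    proof
      assume "U q z = 0"
      moreover have "dominated a b (Suc (Suc (Suc q))) z"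
        using dom[of z] z R by (auto simp: eval_nat_numeral)
      ultimately have "z \<in> eigenvalues (jacobi_operator e a b)"
        using closed_continuant_zero_imp_eigenvalue[OF assms(1-3), where b = b and p = "Suc q" and z = z]
        by (simp add: U_def eval_nat_numeral)
      then show False using z C(2) by blast
    qed
    \<comment> \<open>The quotient is analytic at points of \<open>C\<close>, so
      \<open>remove_sings\<close> returns its value there.\<close>
    have f_eq: "V q z / U q z = f z" if z: "z \<in> C" for z
    proof -
      have "U q analytic_on {z}" "V q analytic_on {z}"
        using holo[OF dom] z R by (auto simp: analytic_at intro!: exI[of _ "ball 0 R"])
      then have "(\<lambda>w. V q w / U q w) analytic_on {z}"
        using nz[OF z] by (intro analytic_intros) auto
      moreover have "f z = remove_sings (\<lambda>w. V q w / U q w) z"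
        unfolding f_def using g_ev[OF dom] z R by (intro remove_sings_cong) auto
      ultimately show ?thesis by simp
    qed
    have "uniform_limit C (jacobi_approximant a b) (\<lambda>z. V q z / U q z) sequentially"
      using jacobi_approximant_uniform_limit(2)[OF dom C(1) R] nz by (simp add: U_def V_def)
    then have "uniform_limit C (jacobi_approximant a b) f sequentially"
      by (rule uniform_limit_cong'[THEN iffD1, rotated 2]) (simp_all only: f_eq)
    moreover have "\<forall>\<^sub>F N in sequentially. \<forall>z\<in>C. \<not> is_pole (jacobi_approximant a b N) z"
      using jacobi_approximant_uniform_limit(1)[OF dom C(1) R] nz by (simp add: U_def)
    ultimately show ?thesis by blast
  qed
  ultimately show ?thesis by blast
qed

end
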